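(* Let $c$ be a real number and let $f\colon D_2\to L_1[0,1]$ be a mapping satisfying $$d(a,b)\le \|f(a)-f(b)\|_1\le c\, d(a,b)\qquad\text{for all } a,b\in D_2,$$ where $D_2$ denotes (the vertex set of) the diamond graph of level $2$ and $d$ is its shortest-path metric. Then $c\ge 5/4$.
   Context: Diamond graphs: $D_0$ has two vertices joined by an edge. For $n\ge 1$, $D_n$ is obtained from $D_{n-1}$ by replacing each edge $uv$ of $D_{n-1}$ by a quadrilateral $u,a,v,b$ with edges $ua$, $av$, $vb$, $bu$, where $a,b$ are two new vertices for each edge $uv$. Thus $D_1$ is a 4-cycle and $D_2$ has $12$ vertices and $16$ edges. Every edge of $D_n$ has length $1$, and $D_n$ is regarded as a metric space on its vertex set with the shortest-path metric $d$. $L_1[0,1]$ is taken with respect to Lebesgue measure. *)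

theory Defs
  imports "HOL-Analysis.Analysis"
begin

text \<open>
  \<open>Mid u v False\<close> and \<open>Mid u v True\<close> are the two new vertices that a subdivision
  step introduces for the edge \<open>uv\<close>.
\<close>

datatype dvertex = Bot | Top | Mid dvertex dvertex bool

text \<open>
  Each undirected edge is listed exactly once, with an auxiliary orientation (from \<open>Bot\<close>
  towards \<open>Top\<close>); the orientation is forgotten in \<open>diamond_adj\<close>.
\<close>

primrec diamond_edges :: "nat \<Rightarrow> (dvertex \<times> dvertex) set" where
  "diamond_edges 0 = {(Bot, Top)}"
| "diamond_edges (Suc n) =
     (\<Union>(u, v) \<in> diamond_edges n. \<Union>i. {(u, Mid u v i), (Mid u v i, v)})"

primrec diamond_verts :: "nat \<Rightarrow> dvertex set" where
  "diamond_verts 0 = {Bot, Top}"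
| "diamond_verts (Suc n) =
     diamond_verts n \<union> (\<Union>(u, v) \<in> diamond_edges n. range (Mid u v))"

definition diamond_adj :: "nat \<Rightarrow> (dvertex \<times> dvertex) set" where
  "diamond_adj n = diamond_edges n \<union> (diamond_edges n)\<inverse>"

text \<open>
  A pair lies in the \<open>k\<close>-th relational power of adjacency iff it is joined by a walk with
  \<open>k\<close> edges. The diamond graphs are connected, so the minimum below is over a nonempty set
  for any two vertices of the graph.
\<close>

definition diamond_dist :: "nat \<Rightarrow> dvertex \<Rightarrow> dvertex \<Rightarrow> nat" where
  "diamond_dist n a b = (LEAST k. (a, b) \<in> diamond_adj n ^^ k)"

text \<open>
  Elements of \<open>L\<^sub>1[0,1]\<close> are represented by integrable functions; \<open>L1_norm\<close> does not depend
  on the choice of representative modulo equality almost everywhere.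
\<close>

definition L1_space :: "(real \<Rightarrow> real) set" where
  "L1_space = {g. integrable (lebesgue_on {0..1}) g}"

definition L1_norm :: "(real \<Rightarrow> real) \<Rightarrow> real" where
  "L1_norm g = (LINT t|lebesgue_on {0..1}. \<bar>g t\<bar>)"

text \<open>The new vertices are indeed new, and levels 1 and 2 have the expected sizes.\<close>

lemma diamond_edges_in_verts:
  "(u, v) \<in> diamond_edges n \<Longrightarrow> u \<in> diamond_verts n \<and> v \<in> diamond_verts n"
  by (induction n arbitrary: u v) (auto, blast+)

lemma diamond_verts_MidD:
  "Mid u v i \<in> diamond_verts n \<Longrightarrow> u \<in> diamond_verts n \<and> v \<in> diamond_verts n"
  by (induction n) (auto dest: diamond_edges_in_verts)

lemma diamond_Mid_fresh:
  "(u, v) \<in> diamond_edges n \<Longrightarrow> Mid u v i \<notin> diamond_verts n"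
  by (induction n arbitrary: u v i)
     (auto dest: diamond_edges_in_verts diamond_verts_MidD)

lemma card_diamond_1: "card (diamond_verts 1) = 4" "card (diamond_edges 1) = 4"
  by (simp_all add: UNIV_bool)

lemma card_diamond_2: "card (diamond_verts 2) = 12" "card (diamond_edges 2) = 16"
  by (simp_all add: UNIV_bool numeral_2_eq_2)

end

theory Submission
  imports Defs
begin

text \<open>
  Take two opposite sides \<open>uv\<close>, \<open>wz\<close> of the 4-cycle \<open>u v z w\<close> formed by \<open>D\<^sub>1\<close>, with new
  vertices \<open>a, b\<close> on \<open>uv\<close> and \<open>c, d\<close> on \<open>wz\<close>. On the real line the sum of the six distances
  between \<open>a, b, c, d\<close>, plus \<open>2 (\<bar>u - v\<bar> + \<bar>w - z\<bar>)\<close>, is at most twice the total length of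
  the eight edges at \<open>a, b, c, d\<close> plus \<open>2 (\<bar>u - w\<bar> + \<bar>v - z\<bar>)\<close>; integrating, the same holds
  in \<open>L\<^sub>1\<close>. Adding the inequalities for the two pairs of opposite sides cancels the terms
  between vertices of \<open>D\<^sub>1\<close>, and the remaining distances give \<open>2 (2 + 2 + 4 \<sqdot> 4) \<le> 2 \<sqdot> 16 c\<close>.
  The coefficients are an optimal solution of the linear program dual to embedding \<open>D\<^sub>2\<close>
  into \<open>L\<^sub>1\<close>.
\<close>

section \<open>Distances in diamond graphs\<close>

lemma diamond_edges_Suc_iff:
  "(x, y) \<in> diamond_edges (Suc n) \<longleftrightarrow>
     (\<exists>u v i. (u, v) \<in> diamond_edges n \<and> (x = u \<and> y = Mid u v i \<or> x = Mid u v i \<and> y = v))"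
  by auto

lemma diamond_adj_sym: "(x, y) \<in> diamond_adj n \<Longrightarrow> (y, x) \<in> diamond_adj n"
  by (auto simp: diamond_adj_def)

lemma diamond_reachable_Bot:
  "x \<in> diamond_verts n \<Longrightarrow> (Bot, x) \<in> (diamond_adj n)\<^sup>*"
proof (induction n arbitrary: x)
  case 0
  then show ?case by (auto simp: diamond_adj_def)
next
  case (Suc n)
  have new: "(u, Mid u v i) \<in> diamond_adj (Suc n)" "(Mid u v i, v) \<in> diamond_adj (Suc n)"
    if "(u, v) \<in> diamond_edges n" for u v i
    using that unfolding diamond_adj_def Un_iff diamond_edges_Suc_iff by blast+
  have "diamond_adj n \<subseteq> (diamond_adj (Suc n))\<^sup>*"
  proof (rule subrelI)
    fix x y assume "(x, y) \<in> diamond_adj n"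
    then consider "(x, y) \<in> diamond_edges n" | "(y, x) \<in> diamond_edges n"
      by (auto simp: diamond_adj_def)
    then show "(x, y) \<in> (diamond_adj (Suc n))\<^sup>*"
      by cases (meson new diamond_adj_sym r_into_rtrancl rtrancl_trans)+
  qed
  then have old: "(Bot, y) \<in> (diamond_adj (Suc n))\<^sup>*" if "y \<in> diamond_verts n" for y
    using Suc.IH[OF that] rtrancl_subset_rtrancl by blast
  from Suc.prems consider "x \<in> diamond_verts n"
    | u v i where "(u, v) \<in> diamond_edges n" "x = Mid u v i"
    by auto
  then show ?case
  proof cases
    case 2
    then show ?thesis
      by (metis diamond_edges_in_verts new(1) old rtrancl.rtrancl_into_rtrancl)
  qed (rule old)
qed

text \<open>Connectedness through \<open>Bot\<close> makes the set under \<open>LEAST\<close>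
  nonempty, so the minimum is attained; otherwise \<open>LEAST\<close> would be an unspecified
  number.\<close>

lemma diamond_dist_walk:
  assumes "x \<in> diamond_verts n" "y \<in> diamond_verts n"
  shows "(x, y) \<in> diamond_adj n ^^ diamond_dist n x y"
proof -
  have "sym ((diamond_adj n)\<^sup>*)"
    by (intro sym_rtrancl symI) (rule diamond_adj_sym)
  then have "(x, y) \<in> (diamond_adj n)\<^sup>*"
    using assms[THEN diamond_reachable_Bot] by (meson rtrancl_trans symD)
  then obtain k where "(x, y) \<in> diamond_adj n ^^ k"
    by (auto simp: rtrancl_power)
  then show ?thesis
    unfolding diamond_dist_def by (rule LeastI)
qed

lemma diamond_dist_edge_le:
  assumes "(x, y) \<in> diamond_edges n"
  shows "diamond_dist n x y \<le> 1" "diamond_dist n y x \<le> 1"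
  using assms unfolding diamond_dist_def by (auto intro!: Least_le simp: diamond_adj_def)

text \<open>Along a walk with \<open>k\<close> edges the potential changes by at most
  \<open>k\<close>. Lower bounds on distances thus reduce to exhibiting a suitable \<phi>.\<close>

lemma diamond_dist_ge_potential:
  fixes \<phi> :: "dvertex \<Rightarrow> int"
  assumes edge: "\<And>x y. (x, y) \<in> diamond_edges n \<Longrightarrow> \<bar>\<phi> x - \<phi> y\<bar> \<le> 1"
    and xy: "x \<in> diamond_verts n" "y \<in> diamond_verts n"
  shows "\<bar>\<phi> x - \<phi> y\<bar> \<le> int (diamond_dist n x y)"
proof -
  have "\<bar>\<phi> x - \<phi> y\<bar> \<le> int k" if "(x, y) \<in> diamond_adj n ^^ k" for k y
    using that
  proof (induction k arbitrary: y)
    case (Suc k)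
    then obtain z where "(x, z) \<in> diamond_adj n ^^ k" and z: "(z, y) \<in> diamond_adj n"
      by auto
    then have "\<bar>\<phi> x - \<phi> z\<bar> \<le> int k" by (intro Suc.IH)
    moreover have "\<bar>\<phi> z - \<phi> y\<bar> \<le> 1"
      using z edge[of z y] edge[of y z] by (auto simp: diamond_adj_def abs_minus_commute)
    ultimately show ?case by simp
  qed simp
  then show ?thesis using diamond_dist_walk[OF xy] .
qed

lemma diamond_Mid_in_verts:
  "(u, v) \<in> diamond_edges n \<Longrightarrow> Mid u v i \<in> diamond_verts (Suc n)"
  by auto

lemma diamond_dist_twins:
  assumes uv: "(u, v) \<in> diamond_edges n"
  shows "2 \<le> diamond_dist (Suc n) (Mid u v False) (Mid u v True)"
proof -
  \<comment> \<open>The twins get 0 and 2. Every edge of level \<open>Suc n\<close> has an endpoint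
    from level \<open>n\<close>, where the value is 1, so no edge sees a jump of 2.\<close>
  define \<phi> :: "dvertex \<Rightarrow> int" where
    "\<phi> x = (if x = Mid u v False then 0 else if x = Mid u v True then 2 else 1)" for x
  have old: "\<phi> p = 1" if "p \<in> diamond_verts n" for p
    using that diamond_Mid_fresh[OF uv] by (auto simp: \<phi>_def)
  have "\<bar>\<phi> x - \<phi> y\<bar> \<le> 1" if xy: "(x, y) \<in> diamond_edges (Suc n)" for x y
  proof -
    from xy have "\<phi> x = 1 \<or> \<phi> y = 1"
      unfolding diamond_edges_Suc_iff by (metis diamond_edges_in_verts old)
    then show ?thesis by (auto simp: \<phi>_def)
  qed
  from diamond_dist_ge_potential[of "Suc n" \<phi>, OF this
      diamond_Mid_in_verts[OF uv, of False] diamond_Mid_in_verts[OF uv, of True]]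
  show ?thesis by (simp add: \<phi>_def)
qed

lemma diamond_dist_disjoint_edges:
  assumes uv: "(u, v) \<in> diamond_edges n" and wz: "(w, z) \<in> diamond_edges n"
    and disj: "{u, v} \<inter> {w, z} = {}"
  shows "4 \<le> diamond_dist (Suc n) (Mid u v i) (Mid w z j)"
proof -
  \<comment> \<open>For \<open>n = 1\<close>, \<open>\<phi>\<close> is the distance to the pair of new vertices on \<open>uv\<close>.\<close>
  define g :: "dvertex \<Rightarrow> int" where "g x = (if x = u \<or> x = v then 1 else 3)" for x
  define \<phi> :: "dvertex \<Rightarrow> int" where
    "\<phi> x = (if x \<in> diamond_verts n then g x
             else case x of Mid p q k \<Rightarrow> g p + g q - 2 | _ \<Rightarrow> 0)" for x
  have new: "\<phi> (Mid p q k) = g p + g q - 2" if "(p, q) \<in> diamond_edges n" for p q k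
    using diamond_Mid_fresh[OF that] by (simp add: \<phi>_def)
  have old: "\<phi> p = g p" if "p \<in> diamond_verts n" for p
    using that by (simp add: \<phi>_def)
  have "\<bar>\<phi> x - \<phi> y\<bar> \<le> 1" if "(x, y) \<in> diamond_edges (Suc n)" for x y
  proof -
    obtain p q k where pq: "(p, q) \<in> diamond_edges n"
      and "x = p \<and> y = Mid p q k \<or> x = Mid p q k \<and> y = q"
      using \<open>(x, y) \<in> diamond_edges (Suc n)\<close> unfolding diamond_edges_Suc_iff by blast
    moreover have "\<phi> p = g p" "\<phi> q = g q"
      using pq diamond_edges_in_verts old by blast+
    \<comment> \<open>The value at \<open>Mid p q k\<close> differs from that at \<open>p\<close> by
      \<open>g q - 2\<close>, and from that at \<open>q\<close> by \<open>g p - 2\<close>.\<close>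
    moreover have "\<bar>g s - 2\<bar> = 1" for s by (simp add: g_def)
    ultimately show ?thesis
      using new[OF pq] by (smt (verit))
  qed
  from diamond_dist_ge_potential[of "Suc n" \<phi>, OF this
      diamond_Mid_in_verts[OF uv, of i] diamond_Mid_in_verts[OF wz, of j]]
  show ?thesis using disj by (simp add: new uv wz g_def)
qed

section \<open>The inequality for two opposite sides\<close>

text \<open>For \<open>m \<le> M\<close> this is the distance from \<open>x\<close> to the interval
  \<open>[m, M]\<close>.\<close>

definition overshoot :: "real \<Rightarrow> real \<Rightarrow> real \<Rightarrow> real" where
  "overshoot m M x = max 0 (max (m - x) (x - M))"

lemma overshoot_nonneg: "0 \<le> overshoot m M x"
  by (simp add: overshoot_def)

text \<open>The segments from \<open>x\<close> to \<open>u\<close> and to \<open>v\<close> both pass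
  through the point of \<open>[m, M]\<close> nearest to \<open>x\<close>; from there on, use the
  triangle inequality.\<close>

lemma overshoot_le:
  assumes "m \<le> u" "u \<le> M" "m \<le> v" "v \<le> M"
  shows "2 * overshoot m M x + dist u v \<le> dist x u + dist x v"
  using assms by (simp add: overshoot_def dist_real_def max_def abs_if)

text \<open>Three points inside the interval have perimeter at most twice its length. Moving a point
  there costs at most its overshoot in each of its two distances.\<close>

lemma triangle_perimeter_le:
  fixes x y z :: real
  assumes "m \<le> M"
  shows "dist x y + dist y z + dist x z \<le>
    2 * (M - m) + 2 * (overshoot m M x + overshoot m M y + overshoot m M z)"
proof -
  have "0 \<le> overshoot m M t" "m - t \<le> overshoot m M t" "t - M \<le> overshoot m M t" for t
    by (simp_all add: overshoot_def)
  note this[of x] this[of y] this[of z]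
  with assms show ?thesis by (simp add: dist_real_def abs_if)
qed

lemma opposite_sides_real:
  fixes u v w z a b c d :: real
  shows "dist a b + dist c d + dist a c + dist a d + dist b c + dist b d
      + 2 * (dist u v + dist w z) \<le>
    2 * (dist a u + dist a v + dist b u + dist b v + dist c w + dist c z + dist d w + dist d z)
      + 2 * (dist u w + dist v z)"
proof -
  define m M where "m = min (min u v) (min w z)" and "M = max (max u v) (max w z)"
  have "m \<le> M" and bounds: "m \<le> u" "u \<le> M" "m \<le> v" "v \<le> M" "m \<le> w" "w \<le> M" "m \<le> z" "z \<le> M"
    by (auto simp: m_def M_def)
  have "M = u \<or> M = v \<or> M = w \<or> M = z" "m = u \<or> m = v \<or> m = w \<or> m = z"
    by (auto simp: M_def m_def max_def min_def)
  \<comment> \<open>The closed tour \<open>u, v, z, w\<close> visits both the minimum and the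
    maximum.\<close>
  then have "2 * (M - m) \<le> dist u v + dist w z + dist u w + dist v z"
    by (elim disjE) (simp_all add: dist_real_def abs_if)
  \<comment> \<open>Each of the six distances lies in two of the four triangles, so they sum to at
    most \<open>4 * (M - m)\<close> plus three times the total overshoot. Twice the
    \<open>overshoot_le\<close> bounds pays for four times that total, and the surplus is
    nonnegative.\<close>
  then show ?thesis
    using triangle_perimeter_le[OF \<open>m \<le> M\<close>, of a b c] triangle_perimeter_le[OF \<open>m \<le> M\<close>, of a b d]
      triangle_perimeter_le[OF \<open>m \<le> M\<close>, of a c d] triangle_perimeter_le[OF \<open>m \<le> M\<close>, of b c d]
      overshoot_nonneg[of m M a] overshoot_nonneg[of m M b]
      overshoot_nonneg[of m M c] overshoot_nonneg[of m M d]
      overshoot_le[OF bounds(1-4), of a] overshoot_le[OF bounds(1-4), of b]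
      overshoot_le[OF bounds(5-8), of c] overshoot_le[OF bounds(5-8), of d]
    unfolding distrib_left by linarith
qed

abbreviation (input) L1_dist :: "(real \<Rightarrow> real) \<Rightarrow> (real \<Rightarrow> real) \<Rightarrow> real" where
  "L1_dist g h \<equiv> L1_norm (\<lambda>t. g t - h t)"

lemma opposite_sides_L1:
  assumes "{u, v, w, z, a, b, c, d} \<subseteq> L1_space"
  shows "L1_dist a b + L1_dist c d + L1_dist a c + L1_dist a d + L1_dist b c + L1_dist b d
      + 2 * (L1_dist u v + L1_dist w z) \<le>
    2 * (L1_dist a u + L1_dist a v + L1_dist b u + L1_dist b v
      + L1_dist c w + L1_dist c z + L1_dist d w + L1_dist d z)
      + 2 * (L1_dist u w + L1_dist v z)"
proof -
  have int: "integrable (lebesgue_on {0..1}) (\<lambda>t. \<bar>g t - h t\<bar>)"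
    if "g \<in> {u, v, w, z, a, b, c, d}" "h \<in> {u, v, w, z, a, b, c, d}" for g h
    using that assms unfolding L1_space_def
    by (intro integrable_abs Bochner_Integration.integrable_diff) auto
  have "(LINT t|lebesgue_on {0..1}. \<bar>a t - b t\<bar> + \<bar>c t - d t\<bar> + \<bar>a t - c t\<bar> + \<bar>a t - d t\<bar>
        + \<bar>b t - c t\<bar> + \<bar>b t - d t\<bar> + 2 * (\<bar>u t - v t\<bar> + \<bar>w t - z t\<bar>)) \<le>
    (LINT t|lebesgue_on {0..1}. 2 * (\<bar>a t - u t\<bar> + \<bar>a t - v t\<bar> + \<bar>b t - u t\<bar> + \<bar>b t - v t\<bar>
        + \<bar>c t - w t\<bar> + \<bar>c t - z t\<bar> + \<bar>d t - w t\<bar> + \<bar>d t - z t\<bar>)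
        + 2 * (\<bar>u t - w t\<bar> + \<bar>v t - z t\<bar>))"
    by (intro integral_mono opposite_sides_real[unfolded dist_real_def]) (simp_all add: int)
  then show ?thesis
    unfolding L1_norm_def by (simp add: int)
qed

theorem theorem12:
  fixes c :: real and f :: "dvertex \<Rightarrow> real \<Rightarrow> real"
  assumes "f \<in> diamond_verts 2 \<rightarrow> L1_space"
    and "\<And>a b. a \<in> diamond_verts 2 \<Longrightarrow> b \<in> diamond_verts 2 \<Longrightarrow>
           real (diamond_dist 2 a b) \<le> L1_norm (\<lambda>t. f a t - f b t) \<and>
           L1_norm (\<lambda>t. f a t - f b t) \<le> c * real (diamond_dist 2 a b)"
  shows "c \<ge> 5 / 4"
proof -
  note Mid_in = diamond_Mid_in_verts[where n = 1, unfolded Suc_1]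
    and twins = diamond_dist_twins[where n = 1, unfolded Suc_1]
    and disjoint = diamond_dist_disjoint_edges[where n = 1, unfolded Suc_1]
    and edges2 = diamond_edges_Suc_iff[where n = 1, unfolded Suc_1]
  let ?d = "\<lambda>x y. L1_dist (f x) (f y)"
  have lower: "real k \<le> ?d x y"
    if "k \<le> diamond_dist 2 x y" "x \<in> diamond_verts 2" "y \<in> diamond_verts 2" for k x y
    using assms(2)[OF that(2,3)] that(1) by linarith
  \<comment> \<open>Edges are only known to have distance at most 1, so bounding their images by
    \<open>c\<close> requires this sign. Any pair at positive distance rules out negative
    \<open>c\<close>; here it comes from disjoint edges of level 1.\<close>
  have "0 \<le> c"
  proof (rule ccontr)
    let ?x = "Mid Bot (Mid Bot Top False) False" and ?y = "Mid (Mid Bot Top True) Top False"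
    assume "\<not> 0 \<le> c"
    then have "c * real (diamond_dist 2 ?x ?y) \<le> 0"
      by (simp add: mult_nonpos_nonneg)
    moreover have "?x \<in> diamond_verts 2" "?y \<in> diamond_verts 2"
      by (auto intro!: Mid_in)
    moreover have "4 \<le> diamond_dist 2 ?x ?y"
      by (rule disjoint) auto
    ultimately show False
      using assms(2)[of ?x ?y] lower[of 4 ?x ?y] by linarith
  qed
  have upper: "?d (Mid p q i) p \<le> c" "?d (Mid p q i) q \<le> c"
    if "(p, q) \<in> diamond_edges 1" for p q i
  proof -
    have e: "(p, Mid p q i) \<in> diamond_edges 2" "(Mid p q i, q) \<in> diamond_edges 2"
      using that unfolding edges2 by blast+
    have "c * real k \<le> c" if "k \<le> 1" for k
      using that \<open>0 \<le> c\<close> by (simp add: mult_left_le)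
    then show "?d (Mid p q i) p \<le> c" "?d (Mid p q i) q \<le> c"
      using e[THEN diamond_edges_in_verts] diamond_dist_edge_le(2)[OF e(1)]
        diamond_dist_edge_le(1)[OF e(2)] assms(2) by (meson order_trans)+
  qed
  \<comment> \<open>Here 20 is 2 + 2 for the twins plus 4 * 4 for the cross pairs, and
    \<open>16 * c\<close> is twice the bound for eight edges.\<close>
  have sides: "20 + 2 * (?d u v + ?d w z) \<le> 16 * c + 2 * (?d u w + ?d v z)"
    if uv: "(u, v) \<in> diamond_edges 1" and wz: "(w, z) \<in> diamond_edges 1"
      and disj: "{u, v} \<inter> {w, z} = {}" for u v w z
  proof -
    have V: "Mid u v i \<in> diamond_verts 2" "Mid w z i \<in> diamond_verts 2" for i
      using Mid_in uv wz by blast+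
    have "{u, v, w, z} \<subseteq> diamond_verts 2"
      using V diamond_verts_MidD by blast
    with V have "{f u, f v, f w, f z, f (Mid u v False), f (Mid u v True),
        f (Mid w z False), f (Mid w z True)} \<subseteq> L1_space"
      using assms(1) by auto
    note opposite_sides_L1[OF this]
    moreover have "real 2 \<le> ?d (Mid u v False) (Mid u v True)"
      "real 2 \<le> ?d (Mid w z False) (Mid w z True)"
      using twins[OF uv] twins[OF wz] V by (blast intro: lower)+
    moreover have "real 4 \<le> ?d (Mid u v i) (Mid w z j)" for i j
      using disjoint[OF uv wz disj] V by (blast intro: lower)
    note this[of False False] this[of False True] this[of True False] this[of True True]
    moreover note upper[OF uv, of False] upper[OF uv, of True]
      upper[OF wz, of False] upper[OF wz, of True]
    ultimately show ?thesis by simp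
  qed
  let ?l = "Mid Bot Top False" and ?r = "Mid Bot Top True"
  have side: "(Bot, Mid Bot Top i) \<in> diamond_edges 1" "(Mid Bot Top i, Top) \<in> diamond_edges 1" for i
    by auto
  \<comment> \<open>Exchanging \<open>?l\<close> and \<open>?r\<close> swaps the two pairs of
    opposite sides, so the sum of both inequalities is \<open>40 \<le> 32 * c\<close>.\<close>
  have "20 + 2 * (?d Bot ?l + ?d ?r Top) \<le> 16 * c + 2 * (?d Bot ?r + ?d ?l Top)"
    and "20 + 2 * (?d Bot ?r + ?d ?l Top) \<le> 16 * c + 2 * (?d Bot ?l + ?d ?r Top)"
    by (rule sides[OF side(1) side(2)], simp)+
  then show ?thesis by simp
qed

end
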